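(* Let $\mathcal{C}$ and $\mathcal{D}$ be small categories. If $\mathcal{C}$ is right dominated by $\mathcal{D}$, then $\mathrm{dcat}(\mathcal{C})\leq\mathrm{dcat}(\mathcal{D})$. Consequently, if $\mathcal{C}$ and $\mathcal{D}$ are right directed homotopy equivalent, then $\mathrm{dcat}(\mathcal{C})=\mathrm{dcat}(\mathcal{D})$.
   Context: All categories are small. For functors $F,G\colon\mathcal{C}\to\mathcal{D}$ write $F\leq_d G$ if there exists a natural transformation $F\Rightarrow G$. The category $\mathcal{C}$ is right dominated by $\mathcal{D}$ if there exist functors $F\colon\mathcal{C}\to\mathcal{D}$ and $G\colon\mathcal{D}\to\mathcal{C}$ with $GF\leq_d1_{\mathcal{C}}$. $\mathcal{C}$ and $\mathcal{D}$ are right directed homotopy equivalent if each is right dominated by the other. A cover of a category $\mathcal{C}$ is a family of (not necessarily full) subcategories such that every morphism of $\mathcal{C}$ belongs to at least one of them. The directed Lusternik–Schnirelmann category $\mathrm{dcat}(\mathcal{C})$ is the least integer $n\geq0$ such that $\mathcal{C}$ admits a cover $\{\mathcal{U}_0,\dots,\mathcal{U}_n\}$ with, for each $i$, an object $c_i\in\mathcal{C}$ and a natural transformation $\overline{c_i}\Rightarrow\iota_i$, where $\overline{c_i}\colon\mathcal{U}_i\to\mathcal{C}$ is the constant functor at $c_i$ and $\iota_i\colon\mathcal{U}_i\hookrightarrow\mathcal{C}$ is the inclusion; $\mathrm{dcat}(\mathcal{C})=\infty$ if no such finite cover exists. *)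

theory Defs
  imports Main "HOL-Library.Extended_Nat"
begin

section \<open>Small categories, functors, natural transformations\<close>

text \<open>
  \<open>Comp C g f\<close> is the composite of \<open>f\<close> followed by \<open>g\<close>, meaningful only when
  \<open>Cod C f = Dom C g\<close>. The fields are total functions; their values outside the carrier
  sets are unconstrained and are never used.
\<close>

record ('o, 'm) cat =
  Obj :: "'o set"
  Arr :: "'m set"
  Dom :: "'m \<Rightarrow> 'o"
  Cod :: "'m \<Rightarrow> 'o"
  Id :: "'o \<Rightarrow> 'm"
  Comp :: "'m \<Rightarrow> 'm \<Rightarrow> 'm"

locale small_category =
  fixes C :: "('o, 'm) cat"
  assumes Dom_in: "f \<in> Arr C \<Longrightarrow> Dom C f \<in> Obj C"
    and Cod_in: "f \<in> Arr C \<Longrightarrow> Cod C f \<in> Obj C"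
    and Id_in: "x \<in> Obj C \<Longrightarrow> Id C x \<in> Arr C"
    and Dom_Id: "x \<in> Obj C \<Longrightarrow> Dom C (Id C x) = x"
    and Cod_Id: "x \<in> Obj C \<Longrightarrow> Cod C (Id C x) = x"
    and Comp_in: "\<lbrakk>f \<in> Arr C; g \<in> Arr C; Cod C f = Dom C g\<rbrakk> \<Longrightarrow> Comp C g f \<in> Arr C"
    and Dom_Comp: "\<lbrakk>f \<in> Arr C; g \<in> Arr C; Cod C f = Dom C g\<rbrakk>
      \<Longrightarrow> Dom C (Comp C g f) = Dom C f"
    and Cod_Comp: "\<lbrakk>f \<in> Arr C; g \<in> Arr C; Cod C f = Dom C g\<rbrakk>
      \<Longrightarrow> Cod C (Comp C g f) = Cod C g"
    and Comp_Id_right: "f \<in> Arr C \<Longrightarrow> Comp C f (Id C (Dom C f)) = f"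
    and Comp_Id_left: "f \<in> Arr C \<Longrightarrow> Comp C (Id C (Cod C f)) f = f"
    and Comp_assoc: "\<lbrakk>f \<in> Arr C; g \<in> Arr C; h \<in> Arr C; Cod C f = Dom C g; Cod C g = Dom C h\<rbrakk>
      \<Longrightarrow> Comp C h (Comp C g f) = Comp C (Comp C h g) f"

record ('o1, 'm1, 'o2, 'm2) fmap =
  on_obj :: "'o1 \<Rightarrow> 'o2"
  on_arr :: "'m1 \<Rightarrow> 'm2"

locale cat_functor = C: small_category C + D: small_category D
  for C :: "('o1, 'm1) cat" and D :: "('o2, 'm2) cat" +
  fixes F :: "('o1, 'm1, 'o2, 'm2) fmap"
  assumes on_obj_in: "x \<in> Obj C \<Longrightarrow> on_obj F x \<in> Obj D"
    and on_arr_in: "f \<in> Arr C \<Longrightarrow> on_arr F f \<in> Arr D"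
    and Dom_on_arr: "f \<in> Arr C \<Longrightarrow> Dom D (on_arr F f) = on_obj F (Dom C f)"
    and Cod_on_arr: "f \<in> Arr C \<Longrightarrow> Cod D (on_arr F f) = on_obj F (Cod C f)"
    and on_arr_Id: "x \<in> Obj C \<Longrightarrow> on_arr F (Id C x) = Id D (on_obj F x)"
    and on_arr_Comp: "\<lbrakk>f \<in> Arr C; g \<in> Arr C; Cod C f = Dom C g\<rbrakk>
      \<Longrightarrow> on_arr F (Comp C g f) = Comp D (on_arr F g) (on_arr F f)"

locale nat_trans = F: cat_functor C D F + G: cat_functor C D G
  for C :: "('o1, 'm1) cat" and D :: "('o2, 'm2) cat"
    and F :: "('o1, 'm1, 'o2, 'm2) fmap" and G :: "('o1, 'm1, 'o2, 'm2) fmap" +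
  fixes \<tau> :: "'o1 \<Rightarrow> 'm2"
  assumes component_in: "x \<in> Obj C \<Longrightarrow> \<tau> x \<in> Arr D"
    and Dom_component: "x \<in> Obj C \<Longrightarrow> Dom D (\<tau> x) = on_obj F x"
    and Cod_component: "x \<in> Obj C \<Longrightarrow> Cod D (\<tau> x) = on_obj G x"
    and naturality: "f \<in> Arr C
      \<Longrightarrow> Comp D (\<tau> (Cod C f)) (on_arr F f) = Comp D (on_arr G f) (\<tau> (Dom C f))"

definition id_functor :: "('o, 'm, 'o, 'm) fmap" where
  "id_functor = \<lparr>on_obj = (\<lambda>x. x), on_arr = (\<lambda>f. f)\<rparr>"

definition comp_functor ::
  "('o2, 'm2, 'o3, 'm3) fmap \<Rightarrow> ('o1, 'm1, 'o2, 'm2) fmap \<Rightarrow> ('o1, 'm1, 'o3, 'm3) fmap" where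
  "comp_functor G F =
    \<lparr>on_obj = (\<lambda>x. on_obj G (on_obj F x)), on_arr = (\<lambda>f. on_arr G (on_arr F f))\<rparr>"

definition const_functor :: "('o2, 'm2) cat \<Rightarrow> 'o2 \<Rightarrow> ('o1, 'm1, 'o2, 'm2) fmap" where
  "const_functor D d = \<lparr>on_obj = (\<lambda>_. d), on_arr = (\<lambda>_. Id D d)\<rparr>"

text \<open>Subcategories need not be full, and may be empty.\<close>

definition subcategory :: "('o, 'm) cat \<Rightarrow> ('o, 'm) cat \<Rightarrow> bool" where
  "subcategory U C \<longleftrightarrow> small_category U \<and> small_category C \<and>
    Obj U \<subseteq> Obj C \<and> Arr U \<subseteq> Arr C \<and>
    (\<forall>f\<in>Arr U. Dom U f = Dom C f \<and> Cod U f = Cod C f) \<and>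
    (\<forall>x\<in>Obj U. Id U x = Id C x) \<and>
    (\<forall>f\<in>Arr U. \<forall>g\<in>Arr U. Cod U f = Dom U g \<longrightarrow> Comp U g f = Comp C g f)"

text \<open>
  Functors do not carry their source and target, so the inclusion of a subcategory has the
  same underlying maps as the identity functor.
\<close>

abbreviation incl_functor :: "('o, 'm, 'o, 'm) fmap" where
  "incl_functor \<equiv> id_functor"

lemma id_cat_functor: "small_category C \<Longrightarrow> cat_functor C C id_functor"
  unfolding cat_functor_def cat_functor_axioms_def id_functor_def by simp

lemma incl_cat_functor: "subcategory U C \<Longrightarrow> cat_functor U C incl_functor"
  unfolding cat_functor_def cat_functor_axioms_def id_functor_def subcategory_def by auto

lemma const_cat_functor:
  assumes "small_category C" "small_category D" "d \<in> Obj D"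
  shows "cat_functor C D (const_functor D d)"
proof -
  interpret D: small_category D by fact
  have "Comp D (Id D d) (Id D d) = Id D d"
    using D.Comp_Id_right[OF D.Id_in[OF assms(3)]] D.Dom_Id[OF assms(3)] by simp
  then show ?thesis
    using assms
    by (simp add: cat_functor_def cat_functor_axioms_def const_functor_def
        D.Id_in D.Dom_Id D.Cod_Id)
qed

lemma comp_cat_functor:
  assumes "cat_functor C D F" "cat_functor D E G"
  shows "cat_functor C E (comp_functor G F)"
proof -
  interpret F: cat_functor C D F by fact
  interpret G: cat_functor D E G by fact
  show ?thesis
    by unfold_locales
      (simp_all add: comp_functor_def F.on_obj_in F.on_arr_in F.Dom_on_arr F.Cod_on_arr
        F.on_arr_Id F.on_arr_Comp G.on_obj_in G.on_arr_in G.Dom_on_arr G.Cod_on_arr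
        G.on_arr_Id G.on_arr_Comp)
qed

section \<open>Directed homotopy and directed Lusternik--Schnirelmann category\<close>

text \<open>\<open>dle C D F G\<close> is the relation \<open>F \<le>\<^sub>d G\<close> for functors from \<open>C\<close> to \<open>D\<close>.\<close>

definition dle :: "('o1, 'm1) cat \<Rightarrow> ('o2, 'm2) cat
    \<Rightarrow> ('o1, 'm1, 'o2, 'm2) fmap \<Rightarrow> ('o1, 'm1, 'o2, 'm2) fmap \<Rightarrow> bool" where
  "dle C D F G \<longleftrightarrow> (\<exists>\<tau>. nat_trans C D F G \<tau>)"

definition right_dominated :: "('o1, 'm1) cat \<Rightarrow> ('o2, 'm2) cat \<Rightarrow> bool" where
  "right_dominated C D \<longleftrightarrow>
    (\<exists>F G. cat_functor C D F \<and> cat_functor D C G \<and> dle C C (comp_functor G F) id_functor)"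

definition right_dhomotopy_equivalent :: "('o1, 'm1) cat \<Rightarrow> ('o2, 'm2) cat \<Rightarrow> bool" where
  "right_dhomotopy_equivalent C D \<longleftrightarrow> right_dominated C D \<and> right_dominated D C"

definition cat_cover :: "('o, 'm) cat \<Rightarrow> 'i set \<Rightarrow> ('i \<Rightarrow> ('o, 'm) cat) \<Rightarrow> bool" where
  "cat_cover C I U \<longleftrightarrow> (\<forall>i\<in>I. subcategory (U i) C) \<and> (\<forall>f\<in>Arr C. \<exists>i\<in>I. f \<in> Arr (U i))"

definition has_dcat_cover :: "('o, 'm) cat \<Rightarrow> nat \<Rightarrow> bool" where
  "has_dcat_cover C n \<longleftrightarrow>
    (\<exists>U. cat_cover C {0..n} U \<and>
      (\<forall>i\<in>{0..n}. \<exists>c\<in>Obj C. dle (U i) C (const_functor C c) incl_functor))"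

text \<open>
  A cover has at least one member and each member needs an object of \<open>C\<close>, so the empty
  category has \<open>dcat = \<infinity>\<close>.
\<close>

definition dcat :: "('o, 'm) cat \<Rightarrow> enat" where
  "dcat C = (if \<exists>n. has_dcat_cover C n then enat (LEAST n. has_dcat_cover C n) else \<infinity>)"

end

(* Pull a cover of D back along F: on the preimage of U, whiskering the contraction of U
   by F and G and composing with GF \<Rightarrow> 1 gives
   const (G c) = G \<circ> const c \<circ> F \<Rightarrow> G \<circ> F \<Rightarrow> incl. *)
theory Submission
  imports Defs
begin

text \<open>Vertical composition: the components are composed in \<open>D\<close>, and naturality
  comes from pasting the squares of \<sigma> and \<tau> along the arrow
  \<open>on_arr G f\<close>.\<close>

lemma dle_trans:
  assumes "dle C D F G" "dle C D G H"
  shows "dle C D F H"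
proof -
  from assms obtain \<sigma> \<tau> where "nat_trans C D F G \<sigma>" "nat_trans C D G H \<tau>"
    unfolding dle_def by blast
  then interpret S: nat_trans C D F G \<sigma> + T: nat_trans C D G H \<tau> .
  have "nat_trans C D F H (\<lambda>x. Comp D (\<tau> x) (\<sigma> x))"
  proof unfold_locales
    fix x assume x: "x \<in> Obj C"
    note comps = S.component_in[OF x] T.component_in[OF x]
      S.Dom_component[OF x] S.Cod_component[OF x] T.Dom_component[OF x] T.Cod_component[OF x]
    show "Comp D (\<tau> x) (\<sigma> x) \<in> Arr D"
      and "Dom D (Comp D (\<tau> x) (\<sigma> x)) = on_obj F x"
      and "Cod D (Comp D (\<tau> x) (\<sigma> x)) = on_obj H x"
      by (simp_all add: comps S.F.D.Comp_in S.F.D.Dom_Comp S.F.D.Cod_Comp)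
  next
    fix f assume f: "f \<in> Arr C"
    let ?x = "Dom C f" and ?y = "Cod C f"
    note x = S.F.C.Dom_in[OF f] and y = S.F.C.Cod_in[OF f]
    note facts = f x y S.component_in T.component_in S.Dom_component S.Cod_component
      T.Dom_component T.Cod_component S.F.on_arr_in S.G.on_arr_in T.G.on_arr_in
      S.F.Dom_on_arr S.F.Cod_on_arr S.G.Dom_on_arr S.G.Cod_on_arr T.G.Dom_on_arr T.G.Cod_on_arr
    have "Comp D (Comp D (\<tau> ?y) (\<sigma> ?y)) (on_arr F f) = Comp D (\<tau> ?y) (Comp D (\<sigma> ?y) (on_arr F f))"
      by (simp add: facts S.F.D.Comp_assoc)
    also have "\<dots> = Comp D (\<tau> ?y) (Comp D (on_arr G f) (\<sigma> ?x))"
      by (simp add: S.naturality[OF f])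
    also have "\<dots> = Comp D (Comp D (\<tau> ?y) (on_arr G f)) (\<sigma> ?x)"
      by (simp add: facts S.F.D.Comp_assoc)
    also have "\<dots> = Comp D (Comp D (on_arr H f) (\<tau> ?x)) (\<sigma> ?x)"
      by (simp add: T.naturality[OF f])
    also have "\<dots> = Comp D (on_arr H f) (Comp D (\<tau> ?x) (\<sigma> ?x))"
      by (simp add: facts S.F.D.Comp_assoc)
    finally show "Comp D (Comp D (\<tau> ?y) (\<sigma> ?y)) (on_arr F f)
      = Comp D (on_arr H f) (Comp D (\<tau> ?x) (\<sigma> ?x))" .
  qed
  then show ?thesis unfolding dle_def by blast
qed

text \<open>A functor preserves commuting squares, so the images
  \<open>on_arr G (\<sigma> x)\<close> are again the components of a transformation.\<close>

lemma dle_whisker_left: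
  assumes "dle C D F F'" "cat_functor D E G"
  shows "dle C E (comp_functor G F) (comp_functor G F')"
proof -
  from assms obtain \<sigma> where "nat_trans C D F F' \<sigma>"
    unfolding dle_def by blast
  then interpret S: nat_trans C D F F' \<sigma> .
  interpret G: cat_functor D E G by fact
  interpret GF: cat_functor C E "comp_functor G F"
    by (rule comp_cat_functor) unfold_locales
  interpret GF': cat_functor C E "comp_functor G F'"
    by (rule comp_cat_functor) unfold_locales
  have "nat_trans C E (comp_functor G F) (comp_functor G F') (\<lambda>x. on_arr G (\<sigma> x))"
  proof unfold_locales
    fix f assume f: "f \<in> Arr C"
    let ?x = "Dom C f" and ?y = "Cod C f"
    note facts = f S.F.C.Dom_in S.F.C.Cod_in S.component_in S.Dom_component S.Cod_component
      S.F.on_arr_in S.G.on_arr_in S.F.Dom_on_arr S.F.Cod_on_arr S.G.Dom_on_arr S.G.Cod_on_arr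
    have "on_arr G (Comp D (\<sigma> ?y) (on_arr F f)) = on_arr G (Comp D (on_arr F' f) (\<sigma> ?x))"
      by (simp add: S.naturality[OF f])
    then show "Comp E (on_arr G (\<sigma> ?y)) (on_arr (comp_functor G F) f)
      = Comp E (on_arr (comp_functor G F') f) (on_arr G (\<sigma> ?x))"
      by (simp add: facts G.on_arr_Comp comp_functor_def)
  qed (simp_all add: comp_functor_def S.component_in S.Dom_component S.Cod_component
      G.on_arr_in G.Dom_on_arr G.Cod_on_arr)
  then show ?thesis unfolding dle_def by blast
qed

text \<open>Reindexing along \<open>F\<close>: the square required at \<open>f\<close> is the square
  of \<sigma> at \<open>on_arr F f\<close>.\<close>

lemma dle_whisker_right:
  assumes "cat_functor C D F" "dle D E G G'"
  shows "dle C E (comp_functor G F) (comp_functor G' F)"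
proof -
  from assms obtain \<sigma> where "nat_trans D E G G' \<sigma>"
    unfolding dle_def by blast
  then interpret S: nat_trans D E G G' \<sigma> .
  interpret F: cat_functor C D F by fact
  interpret GF: cat_functor C E "comp_functor G F"
    by (rule comp_cat_functor) unfold_locales
  interpret GF': cat_functor C E "comp_functor G' F"
    by (rule comp_cat_functor) unfold_locales
  have "nat_trans C E (comp_functor G F) (comp_functor G' F) (\<lambda>x. \<sigma> (on_obj F x))"
  proof unfold_locales
    fix f assume f: "f \<in> Arr C"
    show "Comp E (\<sigma> (on_obj F (Cod C f))) (on_arr (comp_functor G F) f)
      = Comp E (on_arr (comp_functor G' F) f) (\<sigma> (on_obj F (Dom C f)))"
      using S.naturality[OF F.on_arr_in[OF f]]
      by (simp add: f comp_functor_def F.Dom_on_arr F.Cod_on_arr)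
  qed (simp_all add: comp_functor_def F.on_obj_in S.component_in S.Dom_component S.Cod_component)
  then show ?thesis unfolding dle_def by blast
qed

text \<open>Only the carriers shrink; the operations stay those of \<open>C\<close>, so the category
  laws and the agreement with \<open>C\<close> are inherited, and closure is what remains to be
  shown.\<close>

definition preimage_cat ::
  "('o1, 'm1) cat \<Rightarrow> ('o1, 'm1, 'o2, 'm2) fmap \<Rightarrow> ('o2, 'm2) cat \<Rightarrow> ('o1, 'm1) cat" where
  "preimage_cat C F U =
    C\<lparr>Obj := {x \<in> Obj C. on_obj F x \<in> Obj U}, Arr := {f \<in> Arr C. on_arr F f \<in> Arr U}\<rparr>"

lemma preimage_cat_simps [simp]:
  "x \<in> Obj (preimage_cat C F U) \<longleftrightarrow> x \<in> Obj C \<and> on_obj F x \<in> Obj U"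
  "f \<in> Arr (preimage_cat C F U) \<longleftrightarrow> f \<in> Arr C \<and> on_arr F f \<in> Arr U"
  "Dom (preimage_cat C F U) = Dom C"
  "Cod (preimage_cat C F U) = Cod C"
  "Id (preimage_cat C F U) = Id C"
  "Comp (preimage_cat C F U) = Comp C"
  by (simp_all add: preimage_cat_def)

context
  fixes C :: "('o1, 'm1) cat" and D U :: "('o2, 'm2) cat" and F
  assumes F: "cat_functor C D F" and U: "subcategory U D"
begin

interpretation F: cat_functor C D F by (rule F)
interpretation U: small_category U using U by (simp add: subcategory_def)

text \<open>Oriented from \<open>D\<close> to \<open>U\<close>, so that images under
  \<open>F\<close> can be rewritten into the structure of \<open>U\<close>, where its closure
  properties apply.\<close>

lemma subcategory_agrees:
  "f \<in> Arr U \<Longrightarrow> Dom D f = Dom U f"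
  "f \<in> Arr U \<Longrightarrow> Cod D f = Cod U f"
  "x \<in> Obj U \<Longrightarrow> Id D x = Id U x"
  "\<lbrakk>f \<in> Arr U; g \<in> Arr U; Cod U f = Dom U g\<rbrakk> \<Longrightarrow> Comp D g f = Comp U g f"
  using U by (auto simp: subcategory_def)

text \<open>This turns composability of two arrows in \<open>C\<close> into composability of their
  images inside \<open>U\<close>.\<close>

lemma Dom_Cod_on_arr_subcategory:
  assumes "f \<in> Arr C" "on_arr F f \<in> Arr U"
  shows "Dom U (on_arr F f) = on_obj F (Dom C f)" "Cod U (on_arr F f) = on_obj F (Cod C f)"
  using F.Dom_on_arr[OF assms(1)] F.Cod_on_arr[OF assms(1)] subcategory_agrees(1,2)[OF assms(2)]
  by simp_all

lemma on_arr_Comp_subcategory: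
  assumes "f \<in> Arr C" "on_arr F f \<in> Arr U" "g \<in> Arr C" "on_arr F g \<in> Arr U" "Cod C f = Dom C g"
  shows "on_arr F (Comp C g f) = Comp U (on_arr F g) (on_arr F f)"
  using assms by (simp add: F.on_arr_Comp subcategory_agrees(4) Dom_Cod_on_arr_subcategory)

text \<open>Closure holds because \<open>F\<close> sends endpoints, identities and composites to
  those of \<open>U\<close>, which is itself closed under them. The equations are those of
  \<open>C\<close>.\<close>

lemma small_category_preimage: "small_category (preimage_cat C F U)"
proof
  show "Dom (preimage_cat C F U) f \<in> Obj (preimage_cat C F U)"
    and "Cod (preimage_cat C F U) f \<in> Obj (preimage_cat C F U)"
    if "f \<in> Arr (preimage_cat C F U)" for f
    using that U.Dom_in[of "on_arr F f"] U.Cod_in[of "on_arr F f"]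
    by (simp_all add: F.C.Dom_in F.C.Cod_in Dom_Cod_on_arr_subcategory)
  show "Id (preimage_cat C F U) x \<in> Arr (preimage_cat C F U)"
    if "x \<in> Obj (preimage_cat C F U)" for x
    using that by (simp add: F.C.Id_in F.on_arr_Id subcategory_agrees(3) U.Id_in)
  show "Comp (preimage_cat C F U) g f \<in> Arr (preimage_cat C F U)"
    if "f \<in> Arr (preimage_cat C F U)" "g \<in> Arr (preimage_cat C F U)"
      "Cod (preimage_cat C F U) f = Dom (preimage_cat C F U) g" for f g
    using that by (simp add: F.C.Comp_in on_arr_Comp_subcategory U.Comp_in Dom_Cod_on_arr_subcategory)
qed (simp_all add: F.C.Dom_Id F.C.Cod_Id F.C.Dom_Comp F.C.Cod_Comp F.C.Comp_Id_right
    F.C.Comp_Id_left F.C.Comp_assoc)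

lemma subcategory_preimage: "subcategory (preimage_cat C F U) C"
  unfolding subcategory_def using small_category_preimage F.C.small_category_axioms by auto

text \<open>The contraction of \<open>U\<close> relates functors with source \<open>U\<close>, so
  whiskering it needs \<open>F\<close> as a functor into \<open>U\<close> rather than into
  \<open>D\<close>.\<close>

lemma cat_functor_preimage: "cat_functor (preimage_cat C F U) U F"
proof -
  interpret V: small_category "preimage_cat C F U" by (rule small_category_preimage)
  show ?thesis
    by unfold_locales (simp_all add: Dom_Cod_on_arr_subcategory F.on_arr_Id subcategory_agrees(3) on_arr_Comp_subcategory)
qed

lemma dle_const_preimage:
  assumes G: "cat_functor D C G" and GF: "dle C C (comp_functor G F) id_functor"
    and c: "c \<in> Obj D" and contr: "dle U D (const_functor D c) incl_functor"
  shows "dle (preimage_cat C F U) C (const_functor C (on_obj G c)) incl_functor"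
proof -
  let ?V = "preimage_cat C F U"
  interpret G: cat_functor D C G by (rule G)
  have "dle ?V C (comp_functor G (comp_functor (const_functor D c) F))
      (comp_functor G (comp_functor incl_functor F))"
    by (intro dle_whisker_left[OF _ G] dle_whisker_right[OF cat_functor_preimage contr])
  \<comment> \<open>The transformation from \<open>GF\<close> to the identity lives on all of
    \<open>C\<close>; precomposing with the inclusion restricts it to \<open>?V\<close>.\<close>
  moreover have "dle ?V C (comp_functor (comp_functor G F) incl_functor)
      (comp_functor id_functor incl_functor)"
    by (rule dle_whisker_right[OF incl_cat_functor[OF subcategory_preimage] GF])
  \<comment> \<open>\<open>G\<close> preserves the identity of \<open>c\<close>, so the composite is
    constant on arrows too. The equality is one of total maps, not only of their restrictions to
    \<open>?V\<close>.\<close>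
  moreover have "comp_functor G (comp_functor (const_functor D c) F) = const_functor C (on_obj G c)"
    by (simp add: comp_functor_def const_functor_def G.on_arr_Id[OF c])
  \<comment> \<open>Since inclusions have the underlying maps of the identity, the middle functors
    of the two relations unfold to the same record, and transitivity applies directly.\<close>
  ultimately show ?thesis
    using dle_trans by (simp add: comp_functor_def id_functor_def)
qed

end

text \<open>Pulling back keeps the index set \<open>{0..n}\<close>, hence the same \<open>n\<close>.
  Each arrow \<open>f\<close> is covered because \<open>on_arr F f\<close> lies in some member of
  the cover of \<open>D\<close>; the new contracting objects are the images under \<open>G\<close>
  of the old ones.\<close>

lemma has_dcat_cover_right_dominated:
  assumes "right_dominated C D" "has_dcat_cover D n"
  shows "has_dcat_cover C n"
proof -
  from assms(1) obtain F G where F: "cat_functor C D F" and G: "cat_functor D C G"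
    and GF: "dle C C (comp_functor G F) id_functor"
    unfolding right_dominated_def by blast
  interpret F: cat_functor C D F by (rule F)
  interpret G: cat_functor D C G by (rule G)
  from assms(2) obtain U where U: "\<And>i. i \<in> {0..n} \<Longrightarrow> subcategory (U i) D"
    and cover: "\<And>f. f \<in> Arr D \<Longrightarrow> \<exists>i\<in>{0..n}. f \<in> Arr (U i)"
    and contr: "\<And>i. i \<in> {0..n} \<Longrightarrow> \<exists>c\<in>Obj D. dle (U i) D (const_functor D c) incl_functor"
    unfolding has_dcat_cover_def cat_cover_def by blast
  let ?V = "\<lambda>i. preimage_cat C F (U i)"
  have "cat_cover C {0..n} ?V"
    unfolding cat_cover_def using subcategory_preimage[OF F U] cover[OF F.on_arr_in] by simp
  moreover have "\<exists>c\<in>Obj C. dle (?V i) C (const_functor C c) incl_functor" if "i \<in> {0..n}" for i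
    using contr[OF that] dle_const_preimage[OF F U[OF that] G GF] G.on_obj_in by blast
  ultimately show ?thesis unfolding has_dcat_cover_def by blast
qed

lemma dcat_le_right_dominated:
  assumes "right_dominated C D"
  shows "dcat C \<le> dcat D"
proof (cases "\<exists>n. has_dcat_cover D n")
  case True
  then have "has_dcat_cover C (LEAST n. has_dcat_cover D n)"
    \<comment> \<open>The least \<open>n\<close> for \<open>D\<close> is attained, so a cover of
      \<open>C\<close> of that size bounds the minimum for \<open>C\<close>. If \<open>D\<close> has
      no finite cover, its \<open>dcat\<close> is \<infinity> and the bound is immediate.\<close>
    using has_dcat_cover_right_dominated[OF assms] by (blast intro: LeastI_ex)
  then show ?thesis
    using True by (auto simp: dcat_def intro: Least_le)
qed (simp add: dcat_def)

theorem proposition5p3: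
  fixes C :: "('o1, 'm1) cat" and D :: "('o2, 'm2) cat"
  assumes "small_category C" and "small_category D"
  shows "(right_dominated C D \<longrightarrow> dcat C \<le> dcat D) \<and>
    (right_dhomotopy_equivalent C D \<longrightarrow> dcat C = dcat D)"
  by (auto simp: right_dhomotopy_equivalent_def intro: dcat_le_right_dominated antisym)

end
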